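(* Let $m$ be a positive integer, $k$ an integer with $k>m$, and let $\{f_n\}_{n=1}^{\infty}$ be a non-constant polynomial sequence (i.e. $f_n$ is a non-constant polynomial in $n$) such that $f_n\ge 1$ for all $n\ge1$. For each of the continued fractions below assume that $f_n$ is such that no partial numerator is equal to zero (this holds automatically in cases (i)–(vi)). Then: (i) $\displaystyle K_{n=1}^{\infty}\frac{(mn+k-m)f_n-1}{(mn+k-2m)f_n-2}=\frac{k}{k-m}$. (ii) $\displaystyle K_{n=1}^{\infty}\frac{((n^2-n)m+1)f_n+nm-1}{((n^2-3n+2)m+1)f_n+mn-(2m+2)}=1$. (iii) $\displaystyle K_{n=1}^{\infty}\frac{(n+1)^2f_n+4n+5}{n^2f_n+4n-4}=4$. (iv) $\displaystyle K_{n=1}^{\infty}\frac{f_n(m^2n^2+n(m^2-2m)+1)+mn+m-2}{f_n(m^2n^2-n(m^2+2m)+2m+1)+mn-m-3}=2m^2-2m+1$. (v) $\displaystyle K_{n=1}^{\infty}\frac{f_n(m^2n^2+n(2m-m^2)+1)+mn}{f_n(m^2n^2-n(3m^2-2m)+2m^2-2m+1)+mn-2m-1}=2m+1$. (vi) $\displaystyle K_{n=1}^{\infty}\frac{f_n(n(n+1)m+1)+mn+m-1}{f_n(n(n-1)m+1)+mn-m-2}=2m+1$. (vii) Let $A_n/B_n$ denote the convergents of the continued fraction below and suppose $\lim_{n\to\infty}n^2/B_n=0$. Then $$K_{n=1}^{\infty}\frac{f_n((n-1)^2m+(m-2)(n-1)-1)-m^2n+m-1}{f_n((n-2)^2m+(m-2)(n-2)-1)-m^2(n-2)+m-2}=-1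 .$$ (viii) $\displaystyle K_{n=1}^{\infty}\frac{f_n(n(n+1)m+2n+1)-(m^2(n+1)+m+1)}{f_n(n(n-1)m+2n-1)-(m^2(n-1)+m+2)}=2m+3$. (ix) $\displaystyle K_{n=1}^{\infty}\frac{s_n}{t_n}=\frac{1+5m+16m^2+16m^3}{m+16m^3}$, where $$s_n=-1-8m-32m^2-128m^3-64m^2n+\left(m+16m^3+(1+16m^2)n+4mn^2\right)f_n,$$ $$t_n=-2-8m+96m^2-128m^3-64m^2n+\left(-1+5m-16m^2+16m^3+(1-8m+16m^2)n+4mn^2\right)f_n .$$
   Context: For sequences $\{a_n\}_{n\ge1}$, $\{b_n\}_{n\ge1}$, $K_{n=1}^{N}\frac{a_n}{b_n}$ denotes the finite continued fraction $\cfrac{a_1}{b_1+\cfrac{a_2}{b_2+\cdots+\cfrac{a_N}{b_N}}}$, written as the convergent $A_N/B_N$, where $A_{-1}=1$, $A_0=0$, $B_{-1}=0$, $B_0=1$, and $A_n=b_nA_{n-1}+a_nA_{n-2}$, $B_n=b_nB_{n-1}+a_nB_{n-2}$ for $n\ge1$. $K_{n=1}^{\infty}\frac{a_n}{b_n}$ denotes $\lim_{N\to\infty}A_N/B_N$; a stated value means that $B_N\neq0$ for all large $N$ and that the limit exists and has that value. The partial numerators are the terms $a_n$ (printed above the bar), the partial denominators the terms $b_n$. Polynomials $f_n$ have real coefficients. *)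

theory Defs
  imports "HOL-Computational_Algebra.Polynomial" Complex_Main
begin

text \<open>
  Numerators and denominators of the convergents of the continued fraction with partial
  numerators \<open>a 1, a 2, \<dots>\<close> and partial denominators \<open>b 1, b 2, \<dots>\<close>; the values \<open>a 0\<close> and
  \<open>b 0\<close> are never used.  The equations for \<open>Suc 0\<close> are the general recurrence with the
  values at index -1 (1 for the numerator, 0 for the denominator) substituted.
\<close>

fun cf_num :: "(nat \<Rightarrow> real) \<Rightarrow> (nat \<Rightarrow> real) \<Rightarrow> nat \<Rightarrow> real" where
  "cf_num a b 0 = 0"
| "cf_num a b (Suc 0) = b 1 * 0 + a 1 * 1"
| "cf_num a b (Suc (Suc n)) =
     b (Suc (Suc n)) * cf_num a b (Suc n) + a (Suc (Suc n)) * cf_num a b n"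

fun cf_den :: "(nat \<Rightarrow> real) \<Rightarrow> (nat \<Rightarrow> real) \<Rightarrow> nat \<Rightarrow> real" where
  "cf_den a b 0 = 1"
| "cf_den a b (Suc 0) = b 1 * 1 + a 1 * 0"
| "cf_den a b (Suc (Suc n)) =
     b (Suc (Suc n)) * cf_den a b (Suc n) + a (Suc (Suc n)) * cf_den a b n"

text \<open>
  Division by zero is total in HOL, so that almost all convergents are defined has to be
  required separately.
\<close>

definition cf_has_value :: "(nat \<Rightarrow> real) \<Rightarrow> (nat \<Rightarrow> real) \<Rightarrow> real \<Rightarrow> bool" where
  "cf_has_value a b v \<longleftrightarrow>
     (\<forall>\<^sub>F N in sequentially. cf_den a b N \<noteq> 0) \<and>
     (\<lambda>N. cf_num a b N / cf_den a b N) \<longlonglongrightarrow> v"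

definition nonzero_numerators :: "(nat \<Rightarrow> real) \<Rightarrow> bool" where
  "nonzero_numerators a \<longleftrightarrow> (\<forall>n\<ge>1. a n \<noteq> 0)"

end

theory Submission
  imports Defs
begin

text \<open>
  If \<open>y (n + 1) = a n * y (n - 1) - b n * y n\<close>, then \<open>(-1) ^ n * y (n + 1)\<close> solves the
  three-term recurrence of the convergents, so it equals \<open>y 1 * B n - y 0 * A n\<close>. Hence
  \<open>A n / B n\<close> tends to \<open>y 1 / y 0\<close> as soon as the quotient of \<open>B n\<close> by this solution tends
  to infinity in absolute value. By the determinant formula the increments of that quotient have
  successive ratios \<open>- a n * y (n - 1) / y (n + 1)\<close>; when these are at least 3 in
  absolute value, the last increment dominates the sum of all earlier ones. In each of
  the nine cases the coefficient of \<open>f n\<close> in the \<open>n\<close>-th partial numerator is such a \<open>y\<close>.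
\<close>

section \<open>Sequences whose increments at least triple\<close>

lemma increments_dominate_at_top:
  fixes u :: "nat \<Rightarrow> real"
  assumes growth: "\<forall>\<^sub>F n in sequentially. 3 * \<bar>u (n + 1) - u n\<bar> \<le> \<bar>u (n + 2) - u (n + 1)\<bar>"
    and nz: "\<forall>\<^sub>F n in sequentially. u (n + 1) \<noteq> u n"
  shows "filterlim (\<lambda>n. \<bar>u n\<bar>) at_top sequentially"
proof -
  define e where "e n = \<bar>u (n + 1) - u n\<bar>" for n
  from eventually_conj[OF growth nz] obtain N where
    N: "\<And>n. n \<ge> N \<Longrightarrow> 3 * e n \<le> e (n + 1) \<and> e n > 0"
    unfolding eventually_sequentially e_def by (auto simp: add.assoc)
  \<comment> \<open>The constant 1/2 is 1/3 + 1/9 + ..., the bound for the sum of all earlier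
    increments relative to the current one. It reproduces itself, because e/2 + e = 3e/2 is at most
    half of the next increment.\<close>
  have upper: "\<bar>u (N + j)\<bar> \<le> \<bar>u N\<bar> + e (N + j) / 2" for j
  proof (induction j)
    case 0
    then show ?case by (simp add: e_def)
  next
    case (Suc j)
    have "\<bar>u (N + Suc j)\<bar> \<le> \<bar>u (N + j)\<bar> + e (N + j)" by (simp add: e_def)
    moreover have "3 * e (N + j) \<le> e (N + Suc j)" using N[of "N + j"] by simp
    ultimately show ?case using Suc.IH by simp
  qed
  have e_pos: "e N > 0" using N[of N] by simp
  \<comment> \<open>Growth is in fact geometric, but a linear bound is enough for divergence; it
    survives the step because j + 2 \<le> 3 (j + 1).\<close>
  have e_ge: "(real j + 1) * e N \<le> e (N + j)" for j
  proof (induction j)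
    case (Suc j)
    have "(real (Suc j) + 1) * e N \<le> 3 * ((real j + 1) * e N)"
      using e_pos unfolding mult.assoc[symmetric] by (intro mult_right_mono) simp_all
    also have "\<dots> \<le> 3 * e (N + j)" using Suc.IH by simp
    also have "\<dots> \<le> e (N + Suc j)" using N[of "N + j"] by simp
    finally show ?case .
  qed simp
  \<comment> \<open>By the reverse triangle inequality and \<open>upper\<close>, the next term is at
    least e/2 - |u N| in absolute value, where e is the current increment. The index has the form
    \<open>j + Suc N\<close> so that the final shift can discard a finite prefix.\<close>
  have lower: "- \<bar>u N\<bar> + e N / 2 * real j \<le> \<bar>u (j + Suc N)\<bar>" for j
  proof -
    have "e (N + j) - \<bar>u (N + j)\<bar> \<le> \<bar>u (N + j + 1)\<bar>" by (simp add: e_def)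
    with upper[of j] e_ge[of j] e_pos show ?thesis by (simp add: algebra_simps)
  qed
  have "filterlim (\<lambda>j. - \<bar>u N\<bar> + e N / 2 * real j) at_top sequentially"
    by (rule filterlim_tendsto_add_at_top[OF tendsto_const
        filterlim_tendsto_pos_mult_at_top[OF tendsto_const _ filterlim_real_sequentially]])
      (use e_pos in simp)
  then have "filterlim (\<lambda>j. \<bar>u (j + Suc N)\<bar>) at_top sequentially"
    by (rule filterlim_at_top_mono) (intro always_eventually allI lower)
  then show ?thesis unfolding filterlim_at_top
    using eventually_sequentially_seg[of "\<lambda>n. Z \<le> \<bar>u n\<bar>" "Suc N" for Z] by blast
qed

section \<open>Limits of convergents from a solution of their recurrence\<close>

text \<open>Both sides obey the recurrence of the convergents and agree at 0 and 1. The coefficients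
  can be read off at the formal indices 0 and -1, where (B, A) is (1, 0) and (0, 1), and the
  solution is \<open>y 1\<close> and \<open>- y 0\<close>.\<close>

lemma cf_solution:
  assumes rec: "\<And>n. y (n + 2) = a (n + 1) * y n - b (n + 1) * y (n + 1)"
  shows "(-1) ^ n * y (n + 1) = y 1 * cf_den a b n - y 0 * cf_num a b n"
proof (induction n rule: induct_nat_012)
  case 1
  show ?case using rec[of 0] by (simp add: algebra_simps numeral_2_eq_2)
next
  case (ge2 n)
  have y: "y (Suc (Suc (Suc n))) = a (Suc (Suc n)) * y (Suc n) - b (Suc (Suc n)) * y (Suc (Suc n))"
    using rec[of "Suc n"] by simp
  have "(-1) ^ Suc (Suc n) * y (Suc (Suc n) + 1) =
      b (n + 2) * ((-1) ^ Suc n * y (Suc n + 1)) + a (n + 2) * ((-1) ^ n * y (n + 1))"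
    by (simp add: y algebra_simps numeral_eq_Suc)
  then show ?case unfolding ge2 by (simp add: algebra_simps)
qed simp

text \<open>Up to the sign \<open>(-1) ^ n\<close>, the left side is the Casoratian (discrete
  Wronskian) of the solutions B n and \<open>(-1) ^ n * y (n + 1)\<close>; the alternating sign
  turns its difference into a sum. Each step multiplies it by one partial numerator.\<close>

lemma cf_determinant:
  assumes rec: "\<And>n. y (n + 2) = a (n + 1) * y n - b (n + 1) * y (n + 1)"
  shows "cf_den a b (n + 1) * y (n + 1) + cf_den a b n * y (n + 2) = (\<Prod>i=1..n + 1. a i) * y 0"
proof (induction n)
  case 0
  show ?case using rec[of 0] by simp
next
  case (Suc n)
  have y: "y (Suc (Suc (Suc n))) = a (Suc (Suc n)) * y (Suc n) - b (Suc (Suc n)) * y (Suc (Suc n))"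
    using rec[of "Suc n"] by simp
  have "cf_den a b (Suc n + 1) * y (Suc n + 1) + cf_den a b (Suc n) * y (Suc n + 2)
      = a (n + 2) * (cf_den a b (n + 1) * y (n + 1) + cf_den a b n * y (n + 2))"
    by (simp add: y algebra_simps numeral_eq_Suc)
  then show ?case unfolding Suc.IH by (simp add: numeral_eq_Suc)
qed

text \<open>Nonzero numerators and \<open>y 0 \<noteq> 0\<close> keep the determinant nonzero, so
  the increments of the quotient eventually do not vanish; \<open>growth\<close> makes them at least
  triple.\<close>

lemma cf_has_value_solution:
  assumes rec: "\<And>n. y (n + 2) = a (n + 1) * y n - b (n + 1) * y (n + 1)"
    and a: "nonzero_numerators a" and y0: "y 0 \<noteq> 0"
    and ynz: "\<forall>\<^sub>F n in sequentially. y n \<noteq> 0"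
    and growth: "\<forall>\<^sub>F n in sequentially. 3 * \<bar>y (n + 2)\<bar> \<le> \<bar>a (n + 1) * y n\<bar>"
  shows "cf_has_value a b (y 1 / y 0)"
proof -
  \<comment> \<open>The quotient of B n by the solution \<open>(-1) ^ n * y (n + 1)\<close>; the
    sign is its own inverse and can stand in the numerator.\<close>
  define u where "u n = (-1) ^ n * cf_den a b n / y (n + 1)" for n
  define D where "D n = (\<Prod>i=1..n + 1. a i) * y 0" for n
  have D_nz: "D n \<noteq> 0" for n
    using a y0 by (auto simp: D_def nonzero_numerators_def)
  have D_Suc: "D (n + 1) = a (n + 2) * D n" for n
    by (simp add: D_def numeral_eq_Suc)
  have incr: "\<bar>u (n + 1) - u n\<bar> = \<bar>D n\<bar> / \<bar>y (n + 1) * y (n + 2)\<bar>"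
    if "y (n + 1) \<noteq> 0" "y (n + 2) \<noteq> 0" for n
  proof -
    have "u (n + 1) - u n = - ((-1) ^ n) * D n / (y (n + 1) * y (n + 2))"
      using that unfolding D_def cf_determinant[OF rec, symmetric]
      by (simp add: u_def field_simps)
    then show ?thesis by (simp add: abs_mult)
  qed
  obtain N where N: "\<And>n. n \<ge> N \<Longrightarrow> y n \<noteq> 0 \<and> 3 * \<bar>y (n + 2)\<bar> \<le> \<bar>a (n + 1) * y n\<bar>"
    using eventually_conj[OF ynz growth] unfolding eventually_sequentially by blast
  have u_top: "filterlim (\<lambda>n. \<bar>u n\<bar>) at_top sequentially"
  proof (rule increments_dominate_at_top)
    show "\<forall>\<^sub>F n in sequentially. u (n + 1) \<noteq> u n"
      using eventually_ge_at_top[of N]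
    proof eventually_elim
      case (elim n)
      with incr[of n] N[of "n + 1"] N[of "n + 2"] D_nz[of n] show ?case by auto
    qed
    show "\<forall>\<^sub>F n in sequentially. 3 * \<bar>u (n + 1) - u n\<bar> \<le> \<bar>u (n + 2) - u (n + 1)\<bar>"
      using eventually_ge_at_top[of N]
    proof eventually_elim
      case (elim n)
      have nz: "y (n + 1) \<noteq> 0" "y (n + 2) \<noteq> 0" "y (n + 3) \<noteq> 0"
        using N elim by simp_all
      have g: "3 * \<bar>y (n + 3)\<bar> \<le> \<bar>a (n + 2)\<bar> * \<bar>y (n + 1)\<bar>"
        using N[of "n + 1"] elim by (simp add: numeral_eq_Suc abs_mult)
      \<comment> \<open>With y (n + 3) put into the denominator, the comparison of the two
        increments becomes \<open>g\<close>, the growth hypothesis at n + 1.\<close>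
      have "3 * \<bar>u (n + 1) - u n\<bar> =
          \<bar>D n\<bar> / \<bar>y (n + 1) * y (n + 2) * y (n + 3)\<bar> * (3 * \<bar>y (n + 3)\<bar>)"
        using incr[of n] nz by (simp add: abs_mult field_simps)
      also have "\<dots> \<le> \<bar>D n\<bar> / \<bar>y (n + 1) * y (n + 2) * y (n + 3)\<bar> * (\<bar>a (n + 2)\<bar> * \<bar>y (n + 1)\<bar>)"
        using g by (intro mult_left_mono) simp_all
      also have "\<dots> = \<bar>D (n + 1)\<bar> / \<bar>y (n + 2) * y (n + 3)\<bar>"
        using nz unfolding D_Suc by (simp add: abs_mult field_simps)
      also have "\<dots> = \<bar>u (n + 2) - u (n + 1)\<bar>"
        using incr[of "n + 1"] nz by (simp add: numeral_eq_Suc)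
      finally show ?case .
    qed
  qed
  then have "\<forall>\<^sub>F n in sequentially. \<bar>u n\<bar> > 0"
    unfolding filterlim_at_top_dense by blast
  then have u_nz: "\<forall>\<^sub>F n in sequentially. u n \<noteq> 0" by simp
  \<comment> \<open>A zero denominator would make the numerator of \<open>u n\<close>, hence
    \<open>u n\<close> itself, zero.\<close>
  have den: "\<forall>\<^sub>F n in sequentially. cf_den a b n \<noteq> 0"
    using u_nz by (rule eventually_mono) (auto simp: u_def)
  have "filterlim u at_infinity sequentially"
    by (rule filterlim_norm_at_top_imp_at_infinity) (simp add: u_top)
  then have "(\<lambda>n. inverse (u n)) \<longlonglongrightarrow> 0"
    by (rule filterlim_compose[OF tendsto_inverse_0])
  \<comment> \<open>Dividing \<open>cf_solution\<close> by B n and solving for A n / B n gives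
    exactly this expression.\<close>
  then have "(\<lambda>n. (y 1 - inverse (u n)) / y 0) \<longlonglongrightarrow> (y 1 - 0) / y 0"
    by (intro tendsto_intros y0)
  then have "(\<lambda>n. cf_num a b n / cf_den a b n) \<longlonglongrightarrow> (y 1 - 0) / y 0"
  proof (rule Lim_transform_eventually)
    show "\<forall>\<^sub>F n in sequentially. (y 1 - inverse (u n)) / y 0 = cf_num a b n / cf_den a b n"
      using u_nz den
    proof eventually_elim
      case (elim n)
      have "inverse (u n) = (-1) ^ n * y (n + 1) / cf_den a b n"
        by (cases "even n") (simp_all add: u_def)
      then show ?case
        using elim y0 unfolding cf_solution[OF rec] by (simp add: field_simps)
    qed
  qed
  then show ?thesis using den by (simp add: cf_has_value_def)
qed

text \<open>
  The \<open>f n\<close>-parts of the recurrence for \<open>y\<close> cancel, since \<open>f n\<close> is multiplied by \<open>y n\<close> in the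
  partial numerator and by \<open>y (n - 1)\<close> in the partial denominator.
\<close>

lemma cf_has_value_cancelling:
  fixes y g h :: "real \<Rightarrow> real" and f :: "nat \<Rightarrow> real"
  assumes a: "\<And>n. a n = y (real n) * f n + g (real n)"
    and b: "\<And>n. b n = y (real n - 1) * f n + h (real n)"
    and rec: "\<And>x. y (x + 1) = g x * y (x - 1) - h x * y x"
    and f: "\<And>n. n \<ge> 1 \<Longrightarrow> f n \<ge> 1"
    and nz: "nonzero_numerators a" and y0: "y 0 \<noteq> 0"
    and pos: "\<forall>\<^sub>F x in at_top. y x > 0"
    and large: "\<forall>\<^sub>F x in at_top. y x + g x \<ge> 6"
    and slow: "\<forall>\<^sub>F x in at_top. y (x + 1) \<le> 2 * y (x - 1)"
    and v: "v = y 1 / y 0"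
  shows "cf_has_value a b v"
proof -
  have "cf_has_value a b (y (real 1) / y (real 0))"
  proof (rule cf_has_value_solution[where y = "\<lambda>n. y (real n)"])
    show "y (real (n + 2)) = a (n + 1) * y (real n) - b (n + 1) * y (real (n + 1))" for n
      using rec[of "real n + 1"] by (simp add: a b algebra_simps)
    have ev: "\<forall>\<^sub>F n in sequentially. P (real n)" if "\<forall>\<^sub>F x in at_top. P x" for P
      using that by (rule eventually_compose_filterlim) (rule filterlim_real_sequentially)
    obtain N where N: "\<And>n. n \<ge> N \<Longrightarrow>
        y (real n) > 0 \<and> y (real n) + g (real n) \<ge> 6 \<and> y (real n + 1) \<le> 2 * y (real n - 1)"
      using ev[OF eventually_conj[OF pos eventually_conj[OF large slow]]]
      unfolding eventually_sequentially by blast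
    show "\<forall>\<^sub>F n in sequentially. y (real n) \<noteq> 0"
      using ev[OF pos] by (rule eventually_mono) simp
    show "\<forall>\<^sub>F n in sequentially. 3 * \<bar>y (real (n + 2))\<bar> \<le> \<bar>a (n + 1) * y (real n)\<bar>"
      using eventually_ge_at_top[of N]
    proof eventually_elim
      case (elim n)
      have p: "y (real n) > 0" "y (real n + 1) > 0" "y (real n + 2) > 0"
        using elim N[of n] N[of "n + 1"] N[of "n + 2"] by (simp_all add: add_ac)
      \<comment> \<open>The factor 3 required by \<open>growth\<close> times the factor 2 in
        \<open>slow\<close> gives the 6 demanded in \<open>large\<close>. Since y is positive and f
        is at least 1, y + g is then a lower bound for the partial numerator.\<close>
      have "3 * y (real n + 2) \<le> 6 * y (real n)"
        using elim N[of "n + 1"] by (simp add: add_ac)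
      also have "\<dots> \<le> (y (real n + 1) + g (real n + 1)) * y (real n)"
        using elim N[of "n + 1"] p by (intro mult_right_mono) (simp_all add: add_ac)
      also have "\<dots> \<le> a (n + 1) * y (real n)"
        using p f[of "n + 1"] mult_left_mono[of 1 "f (n + 1)" "y (real n + 1)"]
        by (intro mult_right_mono) (simp_all add: a add_ac)
      finally show ?case using p by (simp add: add_ac)
    qed
  qed (use nz y0 in simp_all)
  then show ?thesis using v by simp
qed

section \<open>Multipliers that are polynomials of degree at most two\<close>

lemma quadratic_at_top:
  fixes A B C :: real
  assumes "A > 0 \<or> A = 0 \<and> B > 0"
  shows "filterlim (\<lambda>x. A * x\<^sup>2 + B * x + C) at_top at_top"
proof -
  have linear: "filterlim (\<lambda>x. c + d * x) at_top at_top" if "d > 0" for c d :: real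
    by (rule filterlim_tendsto_add_at_top[OF tendsto_const
        filterlim_tendsto_pos_mult_at_top[OF tendsto_const that filterlim_ident]])
  \<comment> \<open>Horner form reduces the quadratic to a product of two functions tending to
    infinity.\<close>
  have "filterlim (\<lambda>x. C + x * (B + A * x)) at_top at_top" if "A > 0"
    by (intro filterlim_tendsto_add_at_top[OF tendsto_const]
        filterlim_at_top_mult_at_top[OF filterlim_ident] linear that)
  then show ?thesis
    using assms linear[of B C] by (auto simp: algebra_simps power2_eq_square)
qed

text \<open>The common shape of all nine cases: y is at most quadratic and the parts free of
  \<open>f n\<close> are linear. For A > 0 the quadratic term decides every asymptotic condition;
  for A = 0 the slope of y + g is B + G, which therefore has to be positive too. What is left for
  each case is a polynomial identity.\<close>

lemma cf_has_value_quadratic: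
  fixes A B C G H P Q :: real
  defines "y \<equiv> \<lambda>x. A * x\<^sup>2 + B * x + C"
  assumes "\<And>n. n \<ge> 1 \<Longrightarrow> f n \<ge> 1" and "nonzero_numerators a"
    and lead: "A > 0 \<or> A = 0 \<and> B > 0 \<and> B + G > 0" and "C \<noteq> 0"
    and "\<And>n. a n = y (real n) * f n + (G * real n + H)"
    and "\<And>n. b n = y (real n - 1) * f n + (P * real n + Q)"
    and "\<And>x. y (x + 1) = (G * x + H) * y (x - 1) - (P * x + Q) * y x"
    and "v = (A + B + C) / C"
  shows "cf_has_value a b v"
proof (rule cf_has_value_cancelling[where y = y and f = f
      and g = "\<lambda>x. G * x + H" and h = "\<lambda>x. P * x + Q"])
  have ge: "\<forall>\<^sub>F x in at_top. A * x\<^sup>2 + B' * x + C' \<ge> c" if "A > 0 \<or> A = 0 \<and> B' > 0" for B' C' c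
    using quadratic_at_top[OF that] unfolding filterlim_at_top by blast
  show "\<forall>\<^sub>F x in at_top. y x > 0"
    using quadratic_at_top[of A B C] lead unfolding y_def filterlim_at_top_dense by blast
  show "\<forall>\<^sub>F x in at_top. y x + (G * x + H) \<ge> 6"
    using ge[of "B + G" 6 "C + H", OF disj_forward[OF lead]] by (simp add: y_def algebra_simps)
  show "\<forall>\<^sub>F x in at_top. y (x + 1) \<le> 2 * y (x - 1)"
  proof -
    \<comment> \<open>This polynomial is 2 y (x - 1) - y (x + 1), expanded; its leading coefficient
      is that of y.\<close>
    have "\<forall>\<^sub>F x in at_top. A * x\<^sup>2 + (B - 6 * A) * x + (A - 3 * B + C) \<ge> 0"
      using lead by (intro ge) auto
    then show ?thesis
      by (rule eventually_mono) (simp add: y_def algebra_simps power2_eq_square)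
  qed
qed (use assms in \<open>simp_all add: y_def\<close>)

section \<open>The nine continued fractions\<close>

context
  fixes m :: nat and f :: "nat \<Rightarrow> real"
  assumes m: "0 < m" and f: "\<And>n. n \<ge> 1 \<Longrightarrow> f n \<ge> 1"
begin

lemma real_m_pos: "real m > 0"
  using m by simp

lemma one_le_f_mult:
  assumes "n \<ge> 1" "1 \<le> y"
  shows "1 \<le> f n * y"
  using mult_mono[OF f[OF assms(1)] assms(2)] f[OF assms(1)] by simp

lemma corollary5_i:
  assumes "m < k"
  shows "let a = (\<lambda>n. (real m*real n + real k - real m) * f n - 1);
             b = (\<lambda>n. (real m*real n + real k - 2*real m) * f n - 2)
         in nonzero_numerators a \<and> cf_has_value a b (real k / (real k - real m))"
  (is "let a = ?a; b = ?b in _")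
proof -
  have "?a n > 0" if "n \<ge> 1" for n
  proof -
    \<comment> \<open>For n \<ge> 1 the coefficient is at least k, and k > m \<ge> 1 gives k \<ge>
      2.\<close>
    have "(real m * real n + real k - real m) * f n \<ge> 2 * 1"
      using m assms f[OF that] mult_left_mono[of 1 "real n" "real m"] that
      by (intro mult_mono) linarith+
    then show ?thesis by simp
  qed
  then have nz: "nonzero_numerators ?a"
    unfolding nonzero_numerators_def by (metis less_irrefl)
  have C_nz: "real k - real m \<noteq> 0" using assms by simp
  have "cf_has_value ?a ?b (real k / (real k - real m))"
    \<comment> \<open>The one case with a linear multiplier, y x = m x + k - m.\<close>
    by (rule cf_has_value_quadratic[where f = f and A = 0 and B = "real m" and C = "real k - real m"
        and G = 0 and H = "-1" and P = 0 and Q = "-2", OF f nz _ C_nz];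
        (algebra | use real_m_pos in \<open>simp add: algebra_simps\<close>))
  with nz show ?thesis by (simp only: Let_def)
qed

lemma corollary5_ii:
  "let a = (\<lambda>n. ((real n^2 - real n)*real m + 1) * f n + real n*real m - 1);
       b = (\<lambda>n. ((real n^2 - 3*real n + 2)*real m + 1) * f n + real m*real n - (2*real m + 2))
   in nonzero_numerators a \<and> cf_has_value a b 1"
  (is "let a = ?a; b = ?b in _")
proof -
  have "?a n > 0" if "n \<ge> 1" for n
  proof -
    have "real n * (real n - 1) * real m \<ge> 0"
      using that by simp
    then have "((real n ^ 2 - real n) * real m + 1) * f n \<ge> 1"
      using one_le_f_mult[OF that, of "(real n ^ 2 - real n) * real m + 1"]
      by (simp add: power2_eq_square algebra_simps)
    moreover have "real n * real m > 0" using that real_m_pos by simp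
    ultimately show ?thesis by simp
  qed
  then have nz: "nonzero_numerators ?a"
    unfolding nonzero_numerators_def by (metis less_irrefl)
  moreover have "cf_has_value ?a ?b 1"
    by (rule cf_has_value_quadratic[where f = f and A = "real m" and B = "-real m" and C = "1"
        and G = "real m" and H = "-1"
        and P = "real m" and Q = "-(2*real m+2)", OF f nz];
        (algebra | use real_m_pos in \<open>simp add: algebra_simps\<close>))
  ultimately show ?thesis by (simp only: Let_def)
qed

lemma corollary5_iii:
  "let a = (\<lambda>n. (real n + 1)^2 * f n + 4*real n + 5);
       b = (\<lambda>n. real n^2 * f n + 4*real n - 4)
   in nonzero_numerators a \<and> cf_has_value a b 4"
  (is "let a = ?a; b = ?b in _")
proof -
  have "?a n > 0" if "n \<ge> 1" for n
  proof -
    have "(real n + 1)^2 * f n \<ge> 0" using f[OF that] by simp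
    then show ?thesis by simp
  qed
  then have nz: "nonzero_numerators ?a"
    unfolding nonzero_numerators_def by (metis less_irrefl)
  moreover have "cf_has_value ?a ?b 4"
    by (rule cf_has_value_quadratic[where f = f and A = "1" and B = "2" and C = "1"
        and G = "4" and H = "5"
        and P = "4" and Q = "-4", OF f nz];
        (algebra | use real_m_pos in \<open>simp add: algebra_simps\<close>))
  ultimately show ?thesis by (simp only: Let_def)
qed

lemma corollary5_iv:
  "let a = (\<lambda>n. f n * (real m^2*real n^2 + real n*(real m^2 - 2*real m) + 1) + real m*real n + real m - 2);
       b = (\<lambda>n. f n * (real m^2*real n^2 - real n*(real m^2 + 2*real m) + 2*real m + 1) + real m*real n - real m - 3)
   in nonzero_numerators a \<and> cf_has_value a b (2*real m^2 - 2*real m + 1)"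
  (is "let a = ?a; b = ?b in _")
proof -
  have "?a n > 0" if "n \<ge> 1" for n
  proof -
    have ge: "real m * real n \<ge> 1" "real m \<ge> 1"
      using that m mult_mono[of 1 "real m" 1 "real n"] by simp_all
    \<comment> \<open>This product is y n - 1, so the coefficient of \<open>f n\<close> is at least
      1.\<close>
    have "real m * real n * (real m * real n + real m - 2) \<ge> 0"
      using ge by (intro mult_nonneg_nonneg) simp_all
    then have "1 \<le> f n * (real m^2 * real n^2 + real n * (real m^2 - 2 * real m) + 1)"
      by (intro one_le_f_mult that) (simp add: algebra_simps power2_eq_square)
    with ge show ?thesis by simp
  qed
  then have nz: "nonzero_numerators ?a"
    unfolding nonzero_numerators_def by (metis less_irrefl)
  moreover have "cf_has_value ?a ?b (2*real m^2 - 2*real m + 1)"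
    by (rule cf_has_value_quadratic[where f = f and A = "real m^2" and B = "real m^2-2*real m" and C = "1"
        and G = "real m" and H = "real m-2"
        and P = "real m" and Q = "-real m-3", OF f nz];
        (algebra | use real_m_pos in \<open>simp add: algebra_simps\<close>))
  ultimately show ?thesis by (simp only: Let_def)
qed

lemma corollary5_v:
  "let a = (\<lambda>n. f n * (real m^2*real n^2 + real n*(2*real m - real m^2) + 1) + real m*real n);
       b = (\<lambda>n. f n * (real m^2*real n^2 - real n*(3*real m^2 - 2*real m) + 2*real m^2 - 2*real m + 1) + real m*real n - 2*real m - 1)
   in nonzero_numerators a \<and> cf_has_value a b (2*real m + 1)"
  (is "let a = ?a; b = ?b in _")
proof -
  have "?a n > 0" if "n \<ge> 1" for n
  proof -
    \<comment> \<open>Again y n - 1, regrouped into visibly nonnegative terms.\<close>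
    have "real m^2 * (real n * (real n - 1)) + 2 * (real m * real n) \<ge> 0"
      using that by simp
    then have "1 \<le> f n * (real m^2 * real n^2 + real n * (2 * real m - real m^2) + 1)"
      by (intro one_le_f_mult that) (simp add: algebra_simps power2_eq_square)
    then show ?thesis by (simp add: add_pos_nonneg)
  qed
  then have nz: "nonzero_numerators ?a"
    unfolding nonzero_numerators_def by (metis less_irrefl)
  moreover have "cf_has_value ?a ?b (2*real m + 1)"
    by (rule cf_has_value_quadratic[where f = f and A = "real m^2" and B = "2*real m-real m^2" and C = "1"
        and G = "real m" and H = "0"
        and P = "real m" and Q = "-2*real m-1", OF f nz];
        (algebra | use real_m_pos in \<open>simp add: algebra_simps\<close>))
  ultimately show ?thesis by (simp only: Let_def)
qed

lemma corollary5_vi: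
  "let a = (\<lambda>n. f n * (real n*(real n + 1)*real m + 1) + real m*real n + real m - 1);
       b = (\<lambda>n. f n * (real n*(real n - 1)*real m + 1) + real m*real n - real m - 2)
   in nonzero_numerators a \<and> cf_has_value a b (2*real m + 1)"
  (is "let a = ?a; b = ?b in _")
proof -
  have "?a n > 0" if "n \<ge> 1" for n
  proof -
    have "1 \<le> f n * (real n * (real n + 1) * real m + 1)"
      by (intro one_le_f_mult that) simp
    moreover have "real m * real n > 0" using that real_m_pos by simp
    ultimately show ?thesis using real_m_pos by simp
  qed
  then have nz: "nonzero_numerators ?a"
    unfolding nonzero_numerators_def by (metis less_irrefl)
  moreover have "cf_has_value ?a ?b (2*real m + 1)"
    by (rule cf_has_value_quadratic[where f = f and A = "real m" and B = "real m" and C = "1"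
        and G = "real m" and H = "real m-1"
        and P = "real m" and Q = "-real m-2", OF f nz];
        (algebra | use real_m_pos in \<open>simp add: algebra_simps\<close>))
  ultimately show ?thesis by (simp only: Let_def)
qed

lemma corollary5_vii:
  "let a = (\<lambda>n. f n * ((real n - 1)^2*real m + (real m - 2)*(real n - 1) - 1) - real m^2*real n + real m - 1);
       b = (\<lambda>n. f n * ((real n - 2)^2*real m + (real m - 2)*(real n - 2) - 1) - real m^2*(real n - 2) + real m - 2)
   in nonzero_numerators a \<and> (\<lambda>n. (real n)^2 / cf_den a b n) \<longlonglongrightarrow> 0 \<longrightarrow>
      cf_has_value a b (-1)"
  (is "let a = ?a; b = ?b in _")
proof -
  \<comment> \<open>Expanded, y x = m x^2 - (m + 2) x + 1, so y 1 = -1 and y 0 = 1. The multiplier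
    is negative at 1, but only its eventual positivity matters.\<close>
  have "cf_has_value ?a ?b (-1)" if nz: "nonzero_numerators ?a"
    by (rule cf_has_value_quadratic[where f = f and A = "real m" and B = "-real m-2" and C = "1"
        and G = "-(real m^2)" and H = "real m-1"
        and P = "-(real m^2)" and Q = "2*real m^2+real m-2", OF f nz];
        (algebra | use real_m_pos in \<open>simp add: algebra_simps\<close>))
  then show ?thesis by (simp add: Let_def)
qed

lemma corollary5_viii:
  "let a = (\<lambda>n. f n * (real n*(real n + 1)*real m + 2*real n + 1) - (real m^2*(real n + 1) + real m + 1));
       b = (\<lambda>n. f n * (real n*(real n - 1)*real m + 2*real n - 1) - (real m^2*(real n - 1) + real m + 2))
   in nonzero_numerators a \<longrightarrow> cf_has_value a b (2*real m + 3)"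
  (is "let a = ?a; b = ?b in _")
proof -
  \<comment> \<open>The negative slope G is harmless: A = m > 0 lets the quadratic term absorb
    it.\<close>
  have "cf_has_value ?a ?b (2*real m + 3)" if nz: "nonzero_numerators ?a"
    by (rule cf_has_value_quadratic[where f = f and A = "real m" and B = "real m+2" and C = "1"
        and G = "-(real m^2)" and H = "-(real m^2)-real m-1"
        and P = "-(real m^2)" and Q = "real m^2-real m-2", OF f nz];
        (algebra | use real_m_pos in \<open>simp add: algebra_simps\<close>))
  then show ?thesis by (simp add: Let_def)
qed

lemma corollary5_ix:
  "let a = (\<lambda>n. -1 - 8*real m - 32*real m^2 - 128*real m^3 - 64*real m^2*real n
           + (real m + 16*real m^3 + (1 + 16*real m^2)*real n + 4*real m*real n^2) * f n);
       b = (\<lambda>n. -2 - 8*real m + 96*real m^2 - 128*real m^3 - 64*real m^2*real n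
           + (-1 + 5*real m - 16*real m^2 + 16*real m^3 + (1 - 8*real m + 16*real m^2)*real n + 4*real m*real n^2) * f n)
   in nonzero_numerators a \<longrightarrow> cf_has_value a b ((1 + 5*real m + 16*real m^2 + 16*real m^3) / (real m + 16*real m^3))"
  (is "let a = ?a; b = ?b in _")
proof -
  \<comment> \<open>This is y 0, the denominator of the claimed value.\<close>
  have C_nz: "real m + 16 * real m^3 \<noteq> 0"
    using add_pos_pos[OF real_m_pos, of "16 * real m^3"] real_m_pos by simp
  have "cf_has_value ?a ?b ((1 + 5*real m + 16*real m^2 + 16*real m^3) / (real m + 16*real m^3))"
    if nz: "nonzero_numerators ?a"
    by (rule cf_has_value_quadratic[where f = f and A = "4*real m" and B = "1+16*real m^2" and C = "real m+16*real m^3"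
        and G = "-64*real m^2" and H = "-1-8*real m-32*real m^2-128*real m^3"
        and P = "-64*real m^2" and Q = "-2-8*real m+96*real m^2-128*real m^3", OF f nz _ C_nz];
        (algebra | use real_m_pos in \<open>simp add: algebra_simps\<close>))
  then show ?thesis by (simp add: Let_def)
qed

end

theorem corollary5:
  fixes m k :: nat and p :: "real poly" and f :: "nat \<Rightarrow> real"
  assumes "0 < m" and "m < k"
    and "degree p > 0"
    and "\<And>n. n \<ge> 1 \<Longrightarrow> f n = poly p (real n)"
    and "\<And>n. n \<ge> 1 \<Longrightarrow> f n \<ge> 1"
  shows "(let a = (\<lambda>n. (real m*real n + real k - real m) * f n - 1);
          b = (\<lambda>n. (real m*real n + real k - 2*real m) * f n - 2)
      in nonzero_numerators a \<and> cf_has_value a b (real k / (real k - real m)))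
   \<and> (let a = (\<lambda>n. ((real n^2 - real n)*real m + 1) * f n + real n*real m - 1);
          b = (\<lambda>n. ((real n^2 - 3*real n + 2)*real m + 1) * f n + real m*real n - (2*real m + 2))
      in nonzero_numerators a \<and> cf_has_value a b 1)
   \<and> (let a = (\<lambda>n. (real n + 1)^2 * f n + 4*real n + 5);
          b = (\<lambda>n. real n^2 * f n + 4*real n - 4)
      in nonzero_numerators a \<and> cf_has_value a b 4)
   \<and> (let a = (\<lambda>n. f n * (real m^2*real n^2 + real n*(real m^2 - 2*real m) + 1) + real m*real n + real m - 2);
          b = (\<lambda>n. f n * (real m^2*real n^2 - real n*(real m^2 + 2*real m) + 2*real m + 1) + real m*real n - real m - 3)
      in nonzero_numerators a \<and> cf_has_value a b (2*real m^2 - 2*real m + 1))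
   \<and> (let a = (\<lambda>n. f n * (real m^2*real n^2 + real n*(2*real m - real m^2) + 1) + real m*real n);
          b = (\<lambda>n. f n * (real m^2*real n^2 - real n*(3*real m^2 - 2*real m) + 2*real m^2 - 2*real m + 1) + real m*real n - 2*real m - 1)
      in nonzero_numerators a \<and> cf_has_value a b (2*real m + 1))
   \<and> (let a = (\<lambda>n. f n * (real n*(real n + 1)*real m + 1) + real m*real n + real m - 1);
          b = (\<lambda>n. f n * (real n*(real n - 1)*real m + 1) + real m*real n - real m - 2)
      in nonzero_numerators a \<and> cf_has_value a b (2*real m + 1))
   \<and> (let a = (\<lambda>n. f n * ((real n - 1)^2*real m + (real m - 2)*(real n - 1) - 1) - real m^2*real n + real m - 1);
          b = (\<lambda>n. f n * ((real n - 2)^2*real m + (real m - 2)*(real n - 2) - 1) - real m^2*(real n - 2) + real m - 2)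
      in nonzero_numerators a \<and> (\<lambda>n. (real n)^2 / cf_den a b n) \<longlonglongrightarrow> 0 \<longrightarrow>
         cf_has_value a b (-1))
   \<and> (let a = (\<lambda>n. f n * (real n*(real n + 1)*real m + 2*real n + 1) - (real m^2*(real n + 1) + real m + 1));
          b = (\<lambda>n. f n * (real n*(real n - 1)*real m + 2*real n - 1) - (real m^2*(real n - 1) + real m + 2))
      in nonzero_numerators a \<longrightarrow> cf_has_value a b (2*real m + 3))
   \<and> (let a = (\<lambda>n. -1 - 8*real m - 32*real m^2 - 128*real m^3 - 64*real m^2*real n
           + (real m + 16*real m^3 + (1 + 16*real m^2)*real n + 4*real m*real n^2) * f n);
          b = (\<lambda>n. -2 - 8*real m + 96*real m^2 - 128*real m^3 - 64*real m^2*real n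
           + (-1 + 5*real m - 16*real m^2 + 16*real m^3 + (1 - 8*real m + 16*real m^2)*real n + 4*real m*real n^2) * f n)
      in nonzero_numerators a \<longrightarrow> cf_has_value a b ((1 + 5*real m + 16*real m^2 + 16*real m^3) / (real m + 16*real m^3)))"
  using assms(1,2,5)
  by (intro conjI corollary5_i corollary5_ii corollary5_iii corollary5_iv corollary5_v
      corollary5_vi corollary5_vii corollary5_viii corollary5_ix)

end
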